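(* Let $K$ be Chongchitmate and Ng's Legendrian representative of the knot type $m(10_{139})$, presented as the plat closure described in the context, with Legendrian contact homology differential graded algebra $(\mathscr{A},\partial)$ over $\mathbb{Z}[t,t^{-1}]$, where $\mathscr{A}=\mathbb{Z}[t,t^{-1}]\langle x_1,\dots,x_{45}\rangle$ and $\partial$ is the differential listed explicitly in the context. Then the contact homology $\ker(\partial)/\mathrm{Im}\,\partial$ and the characteristic algebra $\mathscr{A}/\langle\mathrm{Im}\,\partial\rangle$ of $K$ over $\mathbb{Z}[t,t^{-1}]$ both vanish identically, i.e. both are zero.
   Context: $\mathbb{Z}[t,t^{-1}]\langle x_1,\dots,x_n\rangle$ denotes the free, noncommutative, unital $\mathbb{Z}[t,t^{-1}]$-algebra on $x_1,\dots,x_n$. For a Legendrian knot with front diagram $F$, the contact homology DGA over $\mathbb{Z}[t,t^{-1}]$ is the free noncommutative unital $\mathbb{Z}[t,t^{-1}]$-algebra generated by the crossings and right cusps of $F$, with differential $\partial$ that is $\mathbb{Z}[t,t^{-1}]$-linear, satisfies $\partial(1)=0$, lowers degree by $1$, satisfies $\partial^2=0$ and the signed Leibniz rule $\partial(vw)=(\partial v)w+(-1)^{|v|}v(\partial w)$ for homogeneous $v$. Only the parity of degrees matters for the signs; $t$ has even degree. $\langle\mathrm{Im}\,\partial\rangle$ is the two-sided ideal of $\mathscr{A}$ generated by $\mathrm{Im}\,\partial$. The contact homology is $\ker(\partial)$ modulo the two-sided ideal of $\ker(\partial)$ generated by $\mathrm{Im}\,\partial$ (which is $\mathrm{Im}\,\partial$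 itself). The knot $K\;(=m(10_{139})$, $m$ standing for mirror$)$: its front diagram is the plat closure, on 14 strands numbered from top to bottom, of the positive braid word (read left to right; the letter $i$ is a crossing of the strands in positions $i$ and $i+1$) $6,7,8,9,10,11,12,13,13,5,7,9,11,2,4,6,8,10,11,13,12,10,11,9,10,8,9,7,8,6,7,5,6,4,5,3,4,2.$ The crossings are labeled $x_1,\dots,x_{38}$ from left to right and the right cusps $x_{39},\dots,x_{45}$ from top to bottom. The generators of even degree are $x_1,x_3,x_5,x_7,x_{19},x_{21},x_{24},x_{25},x_{28},x_{29},x_{32},x_{33},x_{36},x_{37}$; all other generators have odd degree. The differential is: $\partial x_i=0$ for $i\in\{1,3,5,7,9,11,12,13,14,15,20,22\}$; $\partial x_2=-x_1$; $\partial x_4=-x_3$; $\partial x_6=-x_5$; $\partial x_8=-x_7$; $\partial x_{10}=x_1$; $\partial x_{16}=x_2x_{11}+x_{10}x_{11}+x_3$; $\partial x_{17}=x_{11}x_{12}$; $\partial x_{18}=x_{12}x_{13}$; $\partial x_{19}=x_{12}$; $\partial x_{21}=x_{18}x_9x_{20}-x_{19}x_{13}x_9x_{20}+x_{18}-x_{19}x_{13}$; $\partial x_{23}=x_9x_{20}+1+x_{22}x_{13}x_9x_{20}+x_{22}x_{13}$; $\partial x_{24}=x_{11}x_{18}x_{22}+x_{17}x_{13}x_{22}+x_{11}x_{19}+x_{17}$; $\partial x_{25}=x_{11}x_{18}x_{23}+x_{17}x_{13}x_{23}+x_{11}x_{21}-x_{24}x_{13}x_9x_{20}-x_{24}x_{13}$;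 $\partial x_{26}=x_{13}x_{22}+1$; $\partial x_{27}=x_{13}x_{23}+x_{26}x_{13}x_9x_{20}+x_{26}x_{13}$; $\partial x_{28}=x_2x_{17}x_{26}+x_{10}x_{17}x_{26}+x_4x_{12}x_{26}+x_5x_{26}+x_{16}x_{12}x_{26}+x_2x_{24}+x_{10}x_{24}+x_4x_{18}x_{22}+x_{16}x_{18}x_{22}+x_6x_{13}x_{22}+x_7x_{22}+x_4x_{19}+x_{16}x_{19}+x_6$; $\partial x_{29}=x_2x_{17}x_{27}+x_{10}x_{17}x_{27}+x_4x_{12}x_{27}+x_5x_{27}+x_{16}x_{12}x_{27}+x_2x_{25}+x_{10}x_{25}+x_4x_{18}x_{23}+x_{16}x_{18}x_{23}+x_6x_{13}x_{23}+x_7x_{23}+x_4x_{21}+x_{16}x_{21}+x_8x_9x_{20}+x_{20}+x_8-x_{28}x_{13}x_9x_{20}-x_{28}x_{13}$; $\partial x_{30}=x_{12}x_{26}+x_{18}x_{22}+x_{19}$; $\partial x_{31}=x_{12}x_{27}+x_{18}x_{23}+x_{21}+x_{30}x_{13}x_9x_{20}+x_{30}x_{13}$; $\partial x_{32}=x_{15}x_{11}x_{30}+x_{15}x_{17}x_{26}+x_{15}x_{24}$; $\partial x_{33}=x_{15}x_{11}x_{31}+x_{15}x_{17}x_{27}+x_{15}x_{25}-x_{32}x_{13}x_9x_{20}-x_{32}x_{13}$; $\partial x_{34}=x_{11}x_{30}+x_{17}x_{26}+x_{24}$; $\partial x_{35}=x_{11}x_{31}+x_{17}x_{27}+x_{25}+x_{34}x_{13}x_9x_{20}+x_{34}x_{13}$;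 $\partial x_{36}=x_{14}x_{15}x_{34}+x_{14}x_{32}$; $\partial x_{37}=x_{14}x_{15}x_{35}+x_{14}x_{33}-x_{36}x_{13}x_9x_{20}-x_{36}x_{13}$; $\partial x_{38}=x_{15}x_{34}+x_{32}$; $\partial x_{39}=x_{14}x_{38}+x_{36}+1$; $\partial x_{40}=x_{15}x_{35}+x_{33}+x_{38}x_{13}x_9x_{20}+x_{38}x_{13}+1$; $\partial x_{41}=x_{14}x_{15}+1$; $\partial x_{42}=x_{15}x_{11}+1$; $\partial x_{43}=x_2x_{17}+x_{10}x_{17}+x_4x_{12}+x_5+x_{16}x_{12}+1$; $\partial x_{44}=x_{11}x_{18}+x_{17}x_{13}+1$; $\partial x_{45}=x_{18}x_9-x_{19}x_{13}x_9+t^{-1}$. *)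

theory Defs
  imports "HOL-Library.Poly_Mapping" "HOL-Algebra.QuotRing"
begin

section \<open>Free noncommutative algebras\<close>

text \<open>
  \<^typ>\<open>'a \<Rightarrow>\<^sub>0 'b\<close> carries the convolution product of the monoid algebra of an additively
  written monoid.  The free monoid of words under concatenation is therefore written additively
  (its addition is not commutative), and \<open>k\<langle>G\<rangle>\<close> is its monoid algebra.
\<close>

datatype 'g word = Word (letters: "'g list")

instantiation word :: (type) monoid_add
begin

definition zero_word :: "'a word" where
  "0 = Word []"

definition plus_word :: "'a word \<Rightarrow> 'a word \<Rightarrow> 'a word" where
  "v + w = Word (letters v @ letters w)"

instance
  by standard (simp_all add: zero_word_def plus_word_def)

end

type_synonym ('k, 'g) free_algebra = "'g word \<Rightarrow>\<^sub>0 'k"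

definition scalar :: "'k::semiring_1 \<Rightarrow> ('k, 'g) free_algebra" where
  "scalar c = Poly_Mapping.single 0 c"

definition monomial :: "'g list \<Rightarrow> ('k::semiring_1, 'g) free_algebra" where
  "monomial gs = Poly_Mapping.single (Word gs) 1"

section \<open>The DGA of the Legendrian representative of m(10_139)\<close>

text \<open>\<open>\<int>[t,t\<^sup>-\<^sup>1]\<close> is the group algebra of the additive group of integers over \<open>\<int>\<close>.\<close>

type_synonym laurent = "int \<Rightarrow>\<^sub>0 int"

definition t_inv :: laurent where
  "t_inv = Poly_Mapping.single (- 1) 1"

text \<open>
  The front is the plat closure, on 14 strands numbered from top to bottom, of the positive braid
  word 6,7,8,9,10,11,12,13,13,5,7,9,11,2,4,6,8,10,11,13,12,10,11,9,10,8,9,7,8,6,7,5,6,4,5,3,4,2.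
  Generators 1 to 38 are its crossings from left to right, generators 39 to 45 its right cusps
  from top to bottom.
\<close>

typedef generator = "{1..45::nat}" morphisms index Gen
  by (rule exI[of _ 1]) simp

type_synonym dga = "(laurent, generator) free_algebra"

definition X :: "nat \<Rightarrow> dga" where
  "X i = monomial [Gen i]"

text \<open>Only the parity of the degree enters the differential.\<close>

definition even_generator :: "generator \<Rightarrow> bool" where
  "even_generator g \<longleftrightarrow> index g \<in> {1, 3, 5, 7, 19, 21, 24, 25, 28, 29, 32, 33, 36, 37}"

definition gen_sign :: "generator \<Rightarrow> dga" where
  "gen_sign g = (if even_generator g then 1 else - 1)"

definition d_generator :: "generator \<Rightarrow> dga" where
  "d_generator g = (let i = index g in
     if i = 2 then - X 1
     else if i = 4 then - X 3
     else if i = 6 then - X 5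
     else if i = 8 then - X 7
     else if i = 10 then X 1
     else if i = 16 then X 2 * X 11 + X 10 * X 11 + X 3
     else if i = 17 then X 11 * X 12
     else if i = 18 then X 12 * X 13
     else if i = 19 then X 12
     else if i = 21 then X 18 * X 9 * X 20 - X 19 * X 13 * X 9 * X 20 + X 18 - X 19 * X 13
     else if i = 23 then X 9 * X 20 + 1 + X 22 * X 13 * X 9 * X 20 + X 22 * X 13
     else if i = 24 then X 11 * X 18 * X 22 + X 17 * X 13 * X 22 + X 11 * X 19 + X 17
     else if i = 25 then X 11 * X 18 * X 23 + X 17 * X 13 * X 23 + X 11 * X 21 -
         X 24 * X 13 * X 9 * X 20 - X 24 * X 13
     else if i = 26 then X 13 * X 22 + 1
     else if i = 27 then X 13 * X 23 + X 26 * X 13 * X 9 * X 20 + X 26 * X 13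
     else if i = 28 then X 2 * X 17 * X 26 + X 10 * X 17 * X 26 + X 4 * X 12 * X 26 +
         X 5 * X 26 + X 16 * X 12 * X 26 + X 2 * X 24 + X 10 * X 24 + X 4 * X 18 * X 22 +
         X 16 * X 18 * X 22 + X 6 * X 13 * X 22 + X 7 * X 22 + X 4 * X 19 + X 16 * X 19 +
         X 6
     else if i = 29 then X 2 * X 17 * X 27 + X 10 * X 17 * X 27 + X 4 * X 12 * X 27 +
         X 5 * X 27 + X 16 * X 12 * X 27 + X 2 * X 25 + X 10 * X 25 + X 4 * X 18 * X 23 +
         X 16 * X 18 * X 23 + X 6 * X 13 * X 23 + X 7 * X 23 + X 4 * X 21 + X 16 * X 21 +
         X 8 * X 9 * X 20 + X 20 + X 8 - X 28 * X 13 * X 9 * X 20 - X 28 * X 13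
     else if i = 30 then X 12 * X 26 + X 18 * X 22 + X 19
     else if i = 31 then X 12 * X 27 + X 18 * X 23 + X 21 + X 30 * X 13 * X 9 * X 20 +
         X 30 * X 13
     else if i = 32 then X 15 * X 11 * X 30 + X 15 * X 17 * X 26 + X 15 * X 24
     else if i = 33 then X 15 * X 11 * X 31 + X 15 * X 17 * X 27 + X 15 * X 25 -
         X 32 * X 13 * X 9 * X 20 - X 32 * X 13
     else if i = 34 then X 11 * X 30 + X 17 * X 26 + X 24
     else if i = 35 then X 11 * X 31 + X 17 * X 27 + X 25 + X 34 * X 13 * X 9 * X 20 +
         X 34 * X 13
     else if i = 36 then X 14 * X 15 * X 34 + X 14 * X 32
     else if i = 37 then X 14 * X 15 * X 35 + X 14 * X 33 - X 36 * X 13 * X 9 * X 20 -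
         X 36 * X 13
     else if i = 38 then X 15 * X 34 + X 32
     else if i = 39 then X 14 * X 38 + X 36 + 1
     else if i = 40 then X 15 * X 35 + X 33 + X 38 * X 13 * X 9 * X 20 + X 38 * X 13 + 1
     else if i = 41 then X 14 * X 15 + 1
     else if i = 42 then X 15 * X 11 + 1
     else if i = 43 then X 2 * X 17 + X 10 * X 17 + X 4 * X 12 + X 5 + X 16 * X 12 + 1
     else if i = 44 then X 11 * X 18 + X 17 * X 13 + 1
     else if i = 45 then X 18 * X 9 - X 19 * X 13 * X 9 + scalar t_inv
     else 0)"

text \<open>The signed Leibniz rule determines the differential on words, linearity on everything else.\<close>

fun d_letters :: "generator list \<Rightarrow> dga" where
  "d_letters [] = 0"
| "d_letters (g # gs) = d_generator g * monomial gs + gen_sign g * monomial [g] * d_letters gs"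

definition differential :: "dga \<Rightarrow> dga" where
  "differential a =
     (\<Sum>w\<in>Poly_Mapping.keys a. scalar (Poly_Mapping.lookup a w) * d_letters (letters w))"

definition dga_ring :: "dga ring" where
  "dga_ring = \<lparr>carrier = UNIV, monoid.mult = (*), one = 1, ring.zero = 0, add = (+)\<rparr>"

definition cycle_ring :: "dga ring" where
  "cycle_ring = dga_ring\<lparr>carrier := {a. differential a = 0}\<rparr>"

text \<open>
  The image of the differential is already a two-sided ideal of the ring of cycles, so no ideal
  closure is taken here, in contrast to the characteristic algebra.
\<close>

definition contact_homology :: "dga set ring" where
  "contact_homology = cycle_ring Quot (range differential)"

definition characteristic_algebra :: "dga set ring" where
  "characteristic_algebra = dga_ring Quot (Idl\<^bsub>dga_ring\<^esub> (range differential))"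

section \<open>The differential is a derivation of square zero\<close>

lemma ring_dga_ring: "ring dga_ring"
proof -
  have "\<exists>y. x + y = 0" for x :: dga
    using add.right_inverse by blast
  then show ?thesis
    unfolding dga_ring_def using add.right_inverse
    by unfold_locales (auto simp: algebra_simps Units_def)
qed

definition even_word :: "generator word \<Rightarrow> bool" where
  "even_word w \<longleftrightarrow> even (length (filter (\<lambda>g. \<not> even_generator g) (letters w)))"

definition homogeneous :: "bool \<Rightarrow> dga \<Rightarrow> bool" where
  "homogeneous p a \<longleftrightarrow> (\<forall>w\<in>Poly_Mapping.keys a. even_word w = p)"

definition parity_sign :: "bool \<Rightarrow> dga" where
  "parity_sign p = (if p then 1 else - 1)"

lemma scalar_simps:
  "scalar 0 = (0 :: dga)" "scalar 1 = (1 :: dga)"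
  "scalar (c + d) = (scalar c + scalar d :: dga)"
  "scalar (c * d) = (scalar c * scalar d :: dga)"
  by (simp_all add: scalar_def single_add mult_single)

lemma single_eq: "(Poly_Mapping.single w c :: dga) = scalar c * monomial (letters w)"
  by (simp add: scalar_def monomial_def mult_single)

lemma monomial_Nil: "monomial [] = (1 :: dga)"
  by (simp add: monomial_def flip: zero_word_def)

lemma monomial_append: "(monomial (us @ vs) :: dga) = monomial us * monomial vs"
  by (simp add: monomial_def mult_single plus_word_def)

lemma poly_mapping_sum_monomials:
  "(\<Sum>w\<in>Poly_Mapping.keys a. Poly_Mapping.single w (Poly_Mapping.lookup a w)) = a"
proof (rule poly_mapping_eqI)
  fix k
  have "(\<Sum>w\<in>Poly_Mapping.keys a. Poly_Mapping.lookup (Poly_Mapping.single w (Poly_Mapping.lookup a w)) k)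
      = (\<Sum>w\<in>Poly_Mapping.keys a. if k = w then Poly_Mapping.lookup a w else 0)"
    by (intro sum.cong refl) (auto simp: lookup_single)
  then show "Poly_Mapping.lookup (\<Sum>w\<in>Poly_Mapping.keys a.
      Poly_Mapping.single w (Poly_Mapping.lookup a w)) k = Poly_Mapping.lookup a k"
    by (simp add: lookup_sum in_keys_iff)
qed

lemma scalar_central: "scalar c * a = (a :: dga) * scalar c"
proof -
  have *: "Poly_Mapping.single w d * scalar c = (scalar c * Poly_Mapping.single w d :: dga)" for w d
    by (simp add: scalar_def mult_single mult.commute)
  have swap: "scalar c * sum f S = (sum f S :: dga) * scalar c"
    if "\<And>w. scalar c * f w = f w * scalar c" for f :: "generator word \<Rightarrow> dga" and S
    by (simp add: sum_distrib_left sum_distrib_right that)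
  from swap[where f = "\<lambda>w. Poly_Mapping.single w (Poly_Mapping.lookup a w)"
      and S = "Poly_Mapping.keys a", OF *[symmetric]] show ?thesis
    by (simp only: poly_mapping_sum_monomials)
qed

lemma differential_superset:
  assumes "finite S" "Poly_Mapping.keys a \<subseteq> S"
  shows "differential a = (\<Sum>w\<in>S. scalar (Poly_Mapping.lookup a w) * d_letters (letters w))"
  unfolding differential_def
  by (rule sum.mono_neutral_left) (use assms in \<open>auto simp: in_keys_iff scalar_simps\<close>)

lemma differential_add: "differential (a + b) = differential a + differential b"
proof -
  let ?S = "Poly_Mapping.keys a \<union> Poly_Mapping.keys b"
  have "Poly_Mapping.keys (a + b) \<subseteq> ?S"
    by (rule keys_add)
  then show ?thesis
    by (simp add: differential_superset[where S = ?S] lookup_add scalar_simps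
        distrib_right sum.distrib)
qed

lemma differential_0 [simp]: "differential 0 = 0"
  by (simp add: differential_def)

lemma differential_sum: "differential (\<Sum>i\<in>I. f i) = (\<Sum>i\<in>I. differential (f i))"
  by (induction I rule: infinite_finite_induct) (simp_all add: differential_add)

lemma differential_uminus: "differential (- a) = - differential a"
  using differential_add[of a "- a"] by (simp add: eq_neg_iff_add_eq_0 add.commute)

lemma differential_diff: "differential (a - b) = differential a - differential b"
  using differential_add[of a "- b"] by (simp add: differential_uminus)

lemma differential_single:
  "differential (Poly_Mapping.single w c) = scalar c * d_letters (letters w)"
  by (simp add: differential_def scalar_simps)

lemma differential_monomial: "differential (monomial gs) = d_letters gs"
  by (simp add: monomial_def differential_single scalar_simps)

lemma differential_scalar_mult: "differential (scalar c * a) = scalar c * differential a"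
proof -
  have *: "differential (scalar c * Poly_Mapping.single w d) =
      scalar c * differential (Poly_Mapping.single w d)" for w d
    by (simp add: scalar_def[of c] mult_single differential_single)
       (simp add: scalar_simps mult.assoc flip: scalar_def)
  have "a = (\<Sum>w\<in>Poly_Mapping.keys a. Poly_Mapping.single w (Poly_Mapping.lookup a w))"
    by (simp add: poly_mapping_sum_monomials)
  then obtain f where f: "a = (\<Sum>w\<in>Poly_Mapping.keys a. Poly_Mapping.single w (f w))"
    by metis
  have "differential (scalar c * (\<Sum>w\<in>Poly_Mapping.keys a. Poly_Mapping.single w (f w))) =
      scalar c * differential (\<Sum>w\<in>Poly_Mapping.keys a. Poly_Mapping.single w (f w))"
    by (simp add: sum_distrib_left differential_sum *)
  then show ?thesis
    by (simp flip: f)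
qed

lemma differential_scalar [simp]: "differential (scalar c) = 0"
  by (simp add: scalar_def differential_single zero_word_def)

lemma differential_1 [simp]: "differential 1 = 0"
  using differential_scalar[of 1] by (simp add: scalar_simps)

lemma differential_generator: "differential (monomial [g]) = d_generator g"
  by (simp add: differential_monomial monomial_Nil)

lemma d_letters_append:
  "d_letters (us @ vs) = d_letters us * monomial vs +
     parity_sign (even_word (Word us)) * monomial us * d_letters vs"
proof (induction us)
  case Nil
  then show ?case by (simp add: monomial_Nil even_word_def parity_sign_def)
next
  case (Cons g us)
  have "monomial (g # us) = (monomial [g] * monomial us :: dga)"
    by (simp flip: monomial_append)
  then show ?case
    by (simp add: Cons.IH monomial_append gen_sign_def even_word_def parity_sign_def algebra_simps)
qed

lemma differential_mult:
  assumes "homogeneous p a"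
  shows "differential (a * b) = differential a * b + parity_sign p * a * differential b"
proof -
  have word: "differential (Poly_Mapping.single u c * Poly_Mapping.single v d) =
      differential (Poly_Mapping.single u c) * Poly_Mapping.single v d +
      parity_sign (even_word u) * Poly_Mapping.single u c * differential (Poly_Mapping.single v d)"
    for u v c d
  proof -
    have "Poly_Mapping.single u c * Poly_Mapping.single v d =
        scalar (c * d) * (monomial (letters u @ letters v) :: dga)"
      by (simp add: scalar_def monomial_def mult_single plus_word_def zero_word_def)
    then have "differential (Poly_Mapping.single u c * Poly_Mapping.single v d) =
        scalar c * scalar d * d_letters (letters u @ letters v)"
      by (simp only: differential_scalar_mult differential_monomial flip: scalar_simps(4))
    also have "\<dots> = scalar c * (scalar d * d_letters (letters u)) * monomial (letters v) +
        scalar c * parity_sign (even_word u) * (scalar d * monomial (letters u)) *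
          d_letters (letters v)"
      by (simp add: d_letters_append parity_sign_def distrib_left right_diff_distrib mult.assoc)
    also have "\<dots> = scalar c * (d_letters (letters u) * scalar d) * monomial (letters v) +
        scalar c * parity_sign (even_word u) * (monomial (letters u) * scalar d) *
          d_letters (letters v)"
      by (simp only: scalar_central[of d])
    also have "\<dots> = differential (Poly_Mapping.single u c) * Poly_Mapping.single v d +
        parity_sign (even_word u) * Poly_Mapping.single u c * differential (Poly_Mapping.single v d)"
      by (simp only: differential_single) (simp add: single_eq parity_sign_def mult.assoc)
    finally show ?thesis .
  qed
  define A where "A = Poly_Mapping.keys a"
  define B where "B = Poly_Mapping.keys b"
  define f where "f w = (Poly_Mapping.single w (Poly_Mapping.lookup a w) :: dga)" for w
  define h where "h w = (Poly_Mapping.single w (Poly_Mapping.lookup b w) :: dga)" for w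
  have a: "a = sum f A" and b: "b = sum h B"
    by (simp_all add: A_def B_def f_def h_def poly_mapping_sum_monomials)
  have "differential (f u * h v) = differential (f u) * h v + parity_sign p * f u * differential (h v)"
    if "u \<in> A" for u v
  proof -
    have "even_word u = p"
      using assms that by (simp add: homogeneous_def A_def)
    then show ?thesis
      using word[of u _ v] by (simp only: f_def h_def)
  qed
  then have "(\<Sum>u\<in>A. \<Sum>v\<in>B. differential (f u * h v)) =
      (\<Sum>u\<in>A. \<Sum>v\<in>B. differential (f u) * h v + parity_sign p * f u * differential (h v))"
    by (intro sum.cong refl)
  moreover have "differential (a * b) = (\<Sum>u\<in>A. \<Sum>v\<in>B. differential (f u * h v))"
    by (simp add: a b sum_product differential_sum)
  moreover have "differential a * b = (\<Sum>u\<in>A. \<Sum>v\<in>B. differential (f u) * h v)"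
    by (simp only: a b differential_sum sum_product)
  moreover have "parity_sign p * a * differential b =
      (\<Sum>u\<in>A. \<Sum>v\<in>B. parity_sign p * f u * differential (h v))"
    by (simp only: a b differential_sum mult.assoc sum_product) (simp only: sum_distrib_left)
  ultimately show ?thesis
    by (simp add: sum.distrib)
qed

lemma homogeneous_0: "homogeneous p 0"
  by (simp add: homogeneous_def)

lemma homogeneous_add:
  "homogeneous p a \<Longrightarrow> homogeneous p b \<Longrightarrow> homogeneous p (a + b)"
  using keys_add[of a b] by (auto simp: homogeneous_def)

lemma homogeneous_uminus: "homogeneous p a \<Longrightarrow> homogeneous p (- a)"
  by (simp add: homogeneous_def)

lemma homogeneous_diff:
  "homogeneous p a \<Longrightarrow> homogeneous p b \<Longrightarrow> homogeneous p (a - b)"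
  using homogeneous_add[of p a "- b"] by (simp add: homogeneous_uminus)

lemma homogeneous_mult:
  assumes "homogeneous q a" "homogeneous r b" "p = (q = r)"
  shows "homogeneous p (a * b)"
  unfolding homogeneous_def
proof
  fix w
  assume "w \<in> Poly_Mapping.keys (a * b)"
  then obtain u v where "w = u + v" "u \<in> Poly_Mapping.keys a" "v \<in> Poly_Mapping.keys b"
    using keys_mult[of a b] by blast
  moreover have "even_word (u + v) \<longleftrightarrow> even_word u = even_word v"
    by (simp add: even_word_def plus_word_def)
  ultimately show "even_word w = p"
    using assms by (simp add: homogeneous_def)
qed

lemma homogeneous_scalar: "p = True \<Longrightarrow> homogeneous p (scalar c)"
  by (simp add: homogeneous_def scalar_def even_word_def zero_word_def)

lemma homogeneous_1: "p = True \<Longrightarrow> homogeneous p 1"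
  using homogeneous_scalar[of p 1] by (simp add: scalar_simps)

lemma homogeneous_X: "p = even_generator (Gen i) \<Longrightarrow> homogeneous p (X i)"
  by (simp add: homogeneous_def X_def monomial_def even_word_def)

lemmas homogeneous_intros = homogeneous_0 homogeneous_add homogeneous_uminus homogeneous_diff
  homogeneous_mult homogeneous_scalar homogeneous_1 homogeneous_X

lemma even_generator_Gen:
  assumes "i \<in> {1..45}"
  shows "even_generator (Gen i) \<longleftrightarrow>
    i \<in> {1, 3, 5, 7, 19, 21, 24, 25, 28, 29, 32, 33, 36, 37}"
  using assms by (simp add: even_generator_def Gen_inverse)

lemma d_generator_homogeneous: "homogeneous (\<not> even_generator g) (d_generator g)"
proof -
  have if_intro: "homogeneous p (if c then a else b)"
    if "c \<Longrightarrow> homogeneous p a" "homogeneous p b" for p c a b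
    using that by simp
  show ?thesis
    unfolding d_generator_def Let_def
    by (intro if_intro homogeneous_intros refl)
       (simp_all only: even_generator_def[of g], simp_all add: even_generator_Gen)
qed

lemma differential_generator_mult:
  "differential (monomial [g] * b) =
     d_generator g * b + gen_sign g * monomial [g] * differential b"
proof -
  have "homogeneous (even_generator g) (monomial [g])"
    by (simp add: homogeneous_def monomial_def even_word_def)
  then show ?thesis
    by (simp add: differential_mult differential_generator parity_sign_def gen_sign_def)
qed

lemmas differential_X = differential_generator[of "Gen i" for i, folded X_def]
lemmas differential_X_mult = differential_generator_mult[of "Gen i" for i, folded X_def]

lemma differential_d_generator: "differential (d_generator g) = 0"
proof -
  have if_intro: "differential (if c then a else b) = 0"
    if "differential a = 0" "differential b = 0" for c a b
    using that by simp
  show ?thesis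
    unfolding d_generator_def[of g] Let_def
    by (intro if_intro)
       (simp_all only: differential_add differential_diff differential_uminus mult.assoc
          differential_X differential_X_mult differential_0 differential_1 differential_scalar,
        simp_all add: d_generator_def gen_sign_def even_generator_Gen Gen_inverse,
        simp_all add: algebra_simps)
qed

theorem differential_differential: "differential (differential a) = 0"
proof -
  have *: "differential (d_letters gs) = 0" for gs
  proof (induction gs)
    case (Cons g gs)
    have sign: "differential (gen_sign g * b) = gen_sign g * differential b" for b
      by (simp add: gen_sign_def differential_uminus)
    show ?case
      by (simp add: differential_add mult.assoc sign differential_generator_mult Cons.IH
          differential_mult[OF d_generator_homogeneous] differential_d_generator
          differential_monomial)
         (simp add: parity_sign_def gen_sign_def)
  qed simp
  show ?thesis
    by (simp add: differential_def[of a] differential_sum differential_scalar_mult *)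
qed

end

theory Submission
  imports Defs
begin

text \<open>
  Both claims follow once \<open>1\<close> is a boundary.  If \<open>\<partial>a = 1\<close>, then \<open>z = \<partial>(a z)\<close> for every cycle \<open>z\<close>, so
  all cycles are boundaries; and the two-sided ideal generated by the boundaries contains \<open>1\<close>.

  To see that \<open>1\<close> is a boundary, compute in homology, writing \<open>\<sim>\<close> for \<open>homologous\<close>.  The
  elements \<open>\<alpha> = x\<^sub>1\<^sub>8 - x\<^sub>1\<^sub>9x\<^sub>1\<^sub>3\<close> and \<open>\<beta> = x\<^sub>1\<^sub>7 + x\<^sub>1\<^sub>1x\<^sub>1\<^sub>9\<close> are cycles, and the differentials of \<open>x\<^sub>2\<^sub>6\<close>, \<open>x\<^sub>4\<^sub>4\<close>,
  \<open>x\<^sub>2\<^sub>4 - x\<^sub>4\<^sub>4x\<^sub>2\<^sub>2\<close> and \<open>x\<^sub>4\<^sub>5\<close> give, in this order,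
  \<open>x\<^sub>1\<^sub>3x\<^sub>2\<^sub>2 \<sim> -1\<close>, \<open>x\<^sub>1\<^sub>1\<alpha> + \<beta>x\<^sub>1\<^sub>3 \<sim> -1\<close>, \<open>\<beta> \<sim> x\<^sub>2\<^sub>2\<close> and \<open>\<alpha>x\<^sub>9 \<sim> -t\<^sup>-\<^sup>1\<close>.
  Multiplying the second relation by \<open>x\<^sub>1\<^sub>3\<close> from the left and using \<open>x\<^sub>1\<^sub>3\<beta>x\<^sub>1\<^sub>3 \<sim> x\<^sub>1\<^sub>3x\<^sub>2\<^sub>2x\<^sub>1\<^sub>3 \<sim> -x\<^sub>1\<^sub>3\<close> gives
  \<open>x\<^sub>1\<^sub>3x\<^sub>1\<^sub>1\<alpha> \<sim> 0\<close>.  As \<open>\<alpha>\<close> is right invertible, \<open>x\<^sub>1\<^sub>3x\<^sub>1\<^sub>1 \<sim> 0\<close>.  The differentials of \<open>x\<^sub>4\<^sub>1\<close> and \<open>x\<^sub>4\<^sub>2\<close> say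
  that \<open>-x\<^sub>1\<^sub>4\<close> and \<open>-x\<^sub>1\<^sub>1\<close> are a left and a right inverse of \<open>x\<^sub>1\<^sub>5\<close>, so they agree and \<open>x\<^sub>1\<^sub>1\<close> is
  invertible.  Hence \<open>x\<^sub>1\<^sub>3 \<sim> 0\<close>, while \<open>x\<^sub>1\<^sub>3\<close> has the right inverse \<open>-x\<^sub>2\<^sub>2\<close>; therefore \<open>1 \<sim> 0\<close>.
\<close>

text \<open>
  The Leibniz rule applies to the words of \<open>a\<close> one by one, since each is homogeneous; their signs
  differ, but multiply \<open>\<partial>c = 0\<close>.
\<close>

lemma differential_mult_cycle:
  assumes "differential c = 0"
  shows "differential (a * c) = differential a * c"
proof -
  define f where "f w = (Poly_Mapping.single w (Poly_Mapping.lookup a w) :: dga)" for w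
  have a: "a = sum f (Poly_Mapping.keys a)"
    by (simp add: f_def poly_mapping_sum_monomials)
  have homogeneous: "homogeneous (even_word w) (f w)" for w
    by (simp add: homogeneous_def f_def)
  have *: "differential (f w * c) = differential (f w) * c" for w
    by (simp add: differential_mult[OF homogeneous] assms)
  have "differential (sum f A * c) = differential (sum f A) * c" for A
    by (simp add: sum_distrib_right differential_sum *)
  then show ?thesis
    by (metis a)
qed

definition homologous :: "dga \<Rightarrow> dga \<Rightarrow> bool" (infix "\<sim>" 50) where
  "a \<sim> b \<longleftrightarrow> a - b \<in> range differential"

lemma homologousI: "differential y = a - b \<Longrightarrow> a \<sim> b"
  unfolding homologous_def by (metis rangeI)

lemma homologousE:
  assumes "a \<sim> b"
  obtains y where "differential y = a - b"
  using assms unfolding homologous_def by (metis rangeE)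

lemma homologous_sym: "a \<sim> b \<Longrightarrow> b \<sim> a"
  by (metis differential_uminus homologousE homologousI minus_diff_eq)

lemma homologous_add:
  assumes "a \<sim> b" "c \<sim> d"
  shows "a + c \<sim> b + d"
proof -
  obtain u v where "differential u = a - b" "differential v = c - d"
    using assms by (metis homologousE)
  then show ?thesis
    by (intro homologousI[of "u + v"]) (simp add: differential_add)
qed

lemma homologous_trans [trans]: "a \<sim> b \<Longrightarrow> b \<sim> c \<Longrightarrow> a \<sim> c"
  using homologous_add[of a b b c] by (simp add: homologous_def algebra_simps)

lemma homologous_uminus: "a \<sim> b \<Longrightarrow> - a \<sim> - b"
  using homologous_sym[of a b] by (simp add: homologous_def)

lemma homologous_diff: "a \<sim> b \<Longrightarrow> c \<sim> d \<Longrightarrow> a - c \<sim> b - d"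
  using homologous_add[of a b "- c" "- d"] by (simp add: homologous_uminus)

lemma homologous_mult_right:
  assumes "a \<sim> b" "differential c = 0"
  shows "a * c \<sim> b * c"
proof -
  obtain y where "differential y = a - b"
    using assms(1) by (rule homologousE)
  then show ?thesis
    using assms(2)
    by (intro homologousI[of "y * c"]) (simp add: differential_mult_cycle left_diff_distrib)
qed

lemma homologous_mult_left:
  assumes "a \<sim> b" "differential c = 0" "homogeneous p c"
  shows "c * a \<sim> c * b"
proof -
  obtain y where "differential y = a - b"
    using assms(1) by (rule homologousE)
  then show ?thesis
    using assms(2,3)
    by (intro homologousI[of "parity_sign p * c * y"])
      (cases p; simp add: differential_mult differential_uminus parity_sign_def right_diff_distrib)
qed

text \<open>
  The defining case distinction is evaluated once for each generator that enters the argument, so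
  that differentials of products of generators can be computed by rewriting.
\<close>

lemma differential_generators:
  "differential (X 9) = 0" "differential (X 11) = 0" "differential (X 13) = 0"
  "differential (X 14) = 0" "differential (X 15) = 0" "differential (X 22) = 0"
  "differential (X 24) = X 11 * X 18 * X 22 + X 17 * X 13 * X 22 + X 11 * X 19 + X 17"
  "differential (X 26) = X 13 * X 22 + 1" "differential (X 41) = X 14 * X 15 + 1"
  "differential (X 42) = X 15 * X 11 + 1"
  "differential (X 44) = X 11 * X 18 + X 17 * X 13 + 1"
  "differential (X 45) = X 18 * X 9 - X 19 * X 13 * X 9 + scalar t_inv"
  by (simp_all add: differential_X d_generator_def Gen_inverse)

lemma scalar_t_inv_unit: "scalar t_inv * scalar (Poly_Mapping.single 1 1) = (1 :: dga)"
  by (simp add: t_inv_def mult_single flip: scalar_simps)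

lemma X_homogeneous: "homogeneous (even_generator (Gen i)) (X i)"
  by (rule homogeneous_X) simp

text \<open>
  This is the computation sketched at the beginning.  Relations are multiplied only by homogeneous
  cycles, which respect \<open>\<sim>\<close> on either side.
\<close>

lemma one_homologous_zero: "1 \<sim> 0"
proof -
  define \<alpha> where "\<alpha> = X 18 - X 19 * X 13"
  define \<beta> where "\<beta> = X 17 + X 11 * X 19"
  define t where "t = (scalar (Poly_Mapping.single 1 1) :: dga)"
  note d = differential_generators
  have X13_X22: "X 13 * X 22 \<sim> - 1"
    by (rule homologousI[of "X 26"]) (simp add: d)
  have X14_X15: "X 14 * X 15 \<sim> - 1"
    by (rule homologousI[of "X 41"]) (simp add: d)
  have X15_X11: "X 15 * X 11 \<sim> - 1"
    by (rule homologousI[of "X 42"]) (simp add: d)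
  have \<alpha>_X9: "\<alpha> * X 9 \<sim> - scalar t_inv"
    by (rule homologousI[of "X 45"]) (simp add: d \<alpha>_def algebra_simps)
  have sum: "X 11 * \<alpha> + \<beta> * X 13 \<sim> - 1"
    by (rule homologousI[of "X 44"]) (simp add: d \<alpha>_def \<beta>_def algebra_simps)
  (* The boundary of x\<^sub>2\<^sub>4 is (x\<^sub>1\<^sub>1\<alpha> + \<beta>x\<^sub>1\<^sub>3)x\<^sub>2\<^sub>2 + \<beta>; subtracting that of x\<^sub>4\<^sub>4x\<^sub>2\<^sub>2 replaces the bracket
     by -1. *)
  have \<beta>_X22: "\<beta> \<sim> X 22"
    by (rule homologousI[of "X 24 - X 44 * X 22"])
      (simp add: d differential_diff differential_mult_cycle \<beta>_def algebra_simps)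

  have "X 13 * \<beta> \<sim> X 13 * X 22"
    by (rule homologous_mult_left[OF \<beta>_X22 d(3) X_homogeneous])
  also note X13_X22
  finally have "X 13 * \<beta> * X 13 \<sim> - 1 * X 13"
    by (rule homologous_mult_right[OF _ d(3)])
  with homologous_mult_left[OF sum d(3) X_homogeneous]
  have "X 13 * (X 11 * \<alpha> + \<beta> * X 13) - X 13 * \<beta> * X 13 \<sim> X 13 * - 1 - - 1 * X 13"
    by (rule homologous_diff)
  then have "X 13 * X 11 * \<alpha> \<sim> 0"
    by (simp add: distrib_left mult.assoc)
  then have *: "X 13 * X 11 * \<alpha> * X 9 \<sim> 0 * X 9"
    by (rule homologous_mult_right[OF _ d(1)])
  have "X 13 * (X 11 * (\<alpha> * X 9)) \<sim> X 13 * (X 11 * - scalar t_inv)"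
    by (intro homologous_mult_left[OF _ _ X_homogeneous] \<alpha>_X9 d)
  from homologous_trans[OF homologous_sym[OF this]] *
  have "X 13 * (X 11 * - scalar t_inv) \<sim> 0"
    by (simp add: mult.assoc)
  then have "X 13 * (X 11 * - scalar t_inv) * - t \<sim> 0 * - t"
    by (rule homologous_mult_right) (simp add: t_def differential_uminus)
  then have X13_X11: "X 13 * X 11 \<sim> 0"
    by (simp add: mult.assoc t_def scalar_t_inv_unit)

  have "X 14 * - 1 \<sim> X 14 * (X 15 * X 11)"
    by (intro homologous_mult_left[OF _ _ X_homogeneous] homologous_sym[OF X15_X11] d)
  also have "X 14 * (X 15 * X 11) \<sim> - 1 * X 11"
    using homologous_mult_right[OF X14_X15 d(2)] by (simp add: mult.assoc)
  finally have "X 14 \<sim> X 11"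
    using homologous_uminus by fastforce
  then have "X 13 * X 14 \<sim> X 13 * X 11"
    by (rule homologous_mult_left[OF _ d(3) X_homogeneous])
  also note X13_X11
  finally have "X 13 * X 14 * X 15 \<sim> 0 * X 15"
    by (rule homologous_mult_right[OF _ d(5)])
  moreover have "X 13 * - 1 \<sim> X 13 * (X 14 * X 15)"
    by (intro homologous_mult_left[OF _ _ X_homogeneous] homologous_sym[OF X14_X15] d)
  ultimately have "- X 13 \<sim> 0"
    using homologous_trans by (simp add: mult.assoc)
  then have "- X 13 * X 22 \<sim> 0 * X 22"
    by (rule homologous_mult_right[OF _ d(6)])
  moreover have "1 \<sim> - X 13 * X 22"
    using homologous_sym[OF homologous_uminus[OF X13_X22]] by simp
  ultimately show ?thesis
    using homologous_trans by simp
qed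

lemma cycles_eq_boundaries: "{a. differential a = 0} = range differential"
proof
  obtain h where h: "differential h = 1"
    using one_homologous_zero by (metis diff_zero homologousE)
  show "{a. differential a = 0} \<subseteq> range differential"
  proof
    fix a
    assume "a \<in> {a. differential a = 0}"
    then have "a = differential (h * a)"
      by (simp add: differential_mult_cycle h)
    then show "a \<in> range differential"
      by (rule range_eqI)
  qed
qed (auto simp: differential_differential)

lemma quotient_by_carrier_trivial:
  assumes "abelian_group R"
  shows "carrier (R Quot carrier R) = {\<zero>\<^bsub>R Quot carrier R\<^esub>}"
proof -
  interpret abelian_group R
    by fact
  have "carrier R +>\<^bsub>R\<^esub> a = carrier R" if "a \<in> carrier R" for a
    using that a_coset_join2[of a "carrier R"] a_group group.subgroup_self[of "add_monoid R"]
    by simp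
  then show ?thesis
    using zero_closed by (auto simp: FactRing_def A_RCOSETS_def')
qed

lemma abelian_group_cycle_ring: "abelian_group cycle_ring"
proof (rule abelian_groupI)
  fix a
  assume "a \<in> carrier cycle_ring"
  then show "\<exists>b\<in>carrier cycle_ring. b \<oplus>\<^bsub>cycle_ring\<^esub> a = \<zero>\<^bsub>cycle_ring\<^esub>"
    by (intro bexI[of _ "- a"]) (simp_all add: cycle_ring_def dga_ring_def differential_uminus)
qed (simp_all add: cycle_ring_def dga_ring_def differential_add algebra_simps)

theorem proposition1p3:
  shows "carrier contact_homology = {\<zero>\<^bsub>contact_homology\<^esub>} \<and>
         carrier characteristic_algebra = {\<zero>\<^bsub>characteristic_algebra\<^esub>}"
proof
  have "range differential = carrier cycle_ring"
    by (simp add: cycle_ring_def cycles_eq_boundaries)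
  then show "carrier contact_homology = {\<zero>\<^bsub>contact_homology\<^esub>}"
    by (simp add: contact_homology_def quotient_by_carrier_trivial abelian_group_cycle_ring)
next
  interpret ring dga_ring
    by (rule ring_dga_ring)
  have boundaries: "range differential \<subseteq> carrier dga_ring"
    by (simp add: dga_ring_def)
  have "\<one>\<^bsub>dga_ring\<^esub> \<in> range differential"
    using cycles_eq_boundaries by (auto simp: dga_ring_def)
  then have "\<one>\<^bsub>dga_ring\<^esub> \<in> Idl\<^bsub>dga_ring\<^esub> (range differential)"
    using genideal_self[OF boundaries] by blast
  then have "Idl\<^bsub>dga_ring\<^esub> (range differential) = carrier dga_ring"
    by (rule ideal.one_imp_carrier[OF genideal_ideal[OF boundaries]])
  then show "carrier characteristic_algebra = {\<zero>\<^bsub>characteristic_algebra\<^esub>}"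
    by (simp add: characteristic_algebra_def quotient_by_carrier_trivial is_abelian_group)
qed

end
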